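(* For every probability space $V$ there exists an algebraic cone on $V$.
   Context: All vector spaces are over $\mathbb{C}$. Chain complexes are $\mathbb{Z}$-graded with differential of degree $+1$; $\mathbb{C}$ is regarded as a complex concentrated in degree $0$ with zero differential. A (unital commutative homotopy) probability space is a chain complex $(V,d)$ with a chain map $\upsilon:\mathbb{C}\to V$ (the unit, identified with $\upsilon(1)=1\in V$), a graded commutative associative product on $V$ for which $\upsilon(1)$ is the identity (no compatibility between product and $d$ is assumed), and a chain map $e:V\to\mathbb{C}$ (the expectation) with $e\upsilon=\mathrm{id}_{\mathbb{C}}$ (no compatibility between $e$ and the product is assumed). A morphism of probability spaces is a chain map commuting with the units and the expectations; it is not in general required to respect the products. A probability space is contractible if its expectation is a quasi-isomorphism. A cone on a probability space $V$ is a factorization $V\to CV\to\mathbb{C}$ of the expectation $e:V\to\mathbb{C}$, where $CV$ is a contractible probability space with expectation $CV\to\mathbb{C}$ and $V\to CV$ is an injective morphism of probability spaces. An algebraic cone on $V$ is a cone $V\to CV\to\mathbb{C}$ for which $V\to CV$ is also an algebra map (it preserves products). *)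

theory Defs
  imports Complex_Main "HOL-Library.FuncSet" "HOL-Library.Function_Algebras"
begin

text \<open>
  A graded vector space is a family of subspaces \<open>comp V n\<close>, for \<open>n\<close> in the integers, of an
  ambient complex vector space (the type \<open>'a\<close> with scalar multiplication \<open>scal V\<close>). The subspaces
  are not required to be independent: an element of the ambient space may lie in several of them,
  which is why all operations are indexed by degree. The values of operations outside the
  components are irrelevant, and no axiom refers to them.
\<close>

record 'a cochain_complex =
  scal :: "complex \<Rightarrow> 'a \<Rightarrow> 'a"
  comp :: "int \<Rightarrow> 'a set"
  diff :: "int \<Rightarrow> 'a \<Rightarrow> 'a"

definition linear_between ::
  "(complex \<Rightarrow> 'a::ab_group_add \<Rightarrow> 'a) \<Rightarrow> 'a set \<Rightarrow>
   (complex \<Rightarrow> 'b::ab_group_add \<Rightarrow> 'b) \<Rightarrow> 'b set \<Rightarrow> ('a \<Rightarrow> 'b) \<Rightarrow> bool" where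
  "linear_between s A t B f \<longleftrightarrow>
     f \<in> A \<rightarrow> B \<and>
     (\<forall>x\<in>A. \<forall>y\<in>A. f (x + y) = f x + f y) \<and>
     (\<forall>c. \<forall>x\<in>A. f (s c x) = t c (f x))"

definition is_complex :: "('a::ab_group_add, 'm) cochain_complex_scheme \<Rightarrow> bool" where
  "is_complex V \<longleftrightarrow>
     vector_space (scal V) \<and>
     (\<forall>n. module.subspace (scal V) (comp V n)) \<and>
     (\<forall>n. linear_between (scal V) (comp V n) (scal V) (comp V (n + 1)) (diff V n)) \<and>
     (\<forall>n. \<forall>x\<in>comp V n. diff V (n + 1) (diff V n x) = 0)"

definition ground_complex :: "complex cochain_complex" where
  "ground_complex =
     \<lparr>scal = (*), comp = (\<lambda>n. if n = 0 then UNIV else {0}), diff = (\<lambda>_ _. 0)\<rparr>"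

definition chain_map ::
  "('a::ab_group_add, 'm) cochain_complex_scheme \<Rightarrow> ('b::ab_group_add, 'k) cochain_complex_scheme \<Rightarrow>
   (int \<Rightarrow> 'a \<Rightarrow> 'b) \<Rightarrow> bool" where
  "chain_map V W f \<longleftrightarrow>
     (\<forall>n. linear_between (scal V) (comp V n) (scal W) (comp W n) (f n)) \<and>
     (\<forall>n. \<forall>x\<in>comp V n. f (n + 1) (diff V n x) = diff W n (f n x))"

definition cocycles :: "('a::ab_group_add, 'm) cochain_complex_scheme \<Rightarrow> int \<Rightarrow> 'a set" where
  "cocycles V n = {x \<in> comp V n. diff V n x = 0}"

definition coboundaries :: "('a::ab_group_add, 'm) cochain_complex_scheme \<Rightarrow> int \<Rightarrow> 'a set" where
  "coboundaries V n = diff V (n - 1) ` comp V (n - 1)"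

definition cohomologous :: "('a::ab_group_add, 'm) cochain_complex_scheme \<Rightarrow> int \<Rightarrow> ('a \<times> 'a) set" where
  "cohomologous V n = {(x, y). x \<in> cocycles V n \<and> y \<in> cocycles V n \<and> x - y \<in> coboundaries V n}"

definition cohomology :: "('a::ab_group_add, 'm) cochain_complex_scheme \<Rightarrow> int \<Rightarrow> 'a set set" where
  "cohomology V n = cocycles V n // cohomologous V n"

text \<open>For a chain map \<open>f\<close> into \<open>W\<close>, the induced map sends the class of \<open>x\<close> to the class of \<open>f n x\<close>.\<close>

definition cohomology_map ::
  "('b::ab_group_add, 'k) cochain_complex_scheme \<Rightarrow> (int \<Rightarrow> 'a \<Rightarrow> 'b) \<Rightarrow> int \<Rightarrow> 'a set \<Rightarrow> 'b set" where
  "cohomology_map W f n X = cohomologous W n `` (f n ` X)"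

definition quasi_isomorphism ::
  "('a::ab_group_add, 'm) cochain_complex_scheme \<Rightarrow> ('b::ab_group_add, 'k) cochain_complex_scheme \<Rightarrow>
   (int \<Rightarrow> 'a \<Rightarrow> 'b) \<Rightarrow> bool" where
  "quasi_isomorphism V W f \<longleftrightarrow>
     chain_map V W f \<and>
     (\<forall>n. bij_betw (cohomology_map W f n) (cohomology V n) (cohomology W n))"

record 'a homotopy_prob_space = "'a cochain_complex" +
  unit_map :: "int \<Rightarrow> complex \<Rightarrow> 'a"
  mul :: "int \<Rightarrow> int \<Rightarrow> 'a \<Rightarrow> 'a \<Rightarrow> 'a"
  expect :: "int \<Rightarrow> 'a \<Rightarrow> complex"

definition graded_comm_algebra :: "('a::ab_group_add, 'm) homotopy_prob_space_scheme \<Rightarrow> bool" where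
  "graded_comm_algebra V \<longleftrightarrow>
     (\<forall>i j. \<forall>x\<in>comp V i.
        linear_between (scal V) (comp V j) (scal V) (comp V (i + j)) (\<lambda>y. mul V i j x y)) \<and>
     (\<forall>i j. \<forall>y\<in>comp V j.
        linear_between (scal V) (comp V i) (scal V) (comp V (i + j)) (\<lambda>x. mul V i j x y)) \<and>
     (\<forall>i j k. \<forall>x\<in>comp V i. \<forall>y\<in>comp V j. \<forall>z\<in>comp V k.
        mul V (i + j) k (mul V i j x y) z = mul V i (j + k) x (mul V j k y z)) \<and>
     (\<forall>i j. \<forall>x\<in>comp V i. \<forall>y\<in>comp V j.
        mul V i j x y = scal V ((-1) powi (i * j)) (mul V j i y x)) \<and>
     (\<forall>i. \<forall>x\<in>comp V i.
        mul V 0 i (unit_map V 0 1) x = x \<and> mul V i 0 x (unit_map V 0 1) = x)"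

definition is_prob_space :: "('a::ab_group_add, 'm) homotopy_prob_space_scheme \<Rightarrow> bool" where
  "is_prob_space V \<longleftrightarrow>
     is_complex V \<and>
     chain_map ground_complex V (unit_map V) \<and>
     graded_comm_algebra V \<and>
     chain_map V ground_complex (expect V) \<and>
     (\<forall>n. \<forall>c\<in>comp ground_complex n. expect V n (unit_map V n c) = c)"

definition prob_morphism ::
  "('a::ab_group_add, 'm) homotopy_prob_space_scheme \<Rightarrow>
   ('b::ab_group_add, 'k) homotopy_prob_space_scheme \<Rightarrow> (int \<Rightarrow> 'a \<Rightarrow> 'b) \<Rightarrow> bool" where
  "prob_morphism V W f \<longleftrightarrow>
     chain_map V W f \<and>
     (\<forall>n. \<forall>c\<in>comp ground_complex n. f n (unit_map V n c) = unit_map W n c) \<and>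
     (\<forall>n. \<forall>x\<in>comp V n. expect W n (f n x) = expect V n x)"

definition contractible :: "('a::ab_group_add, 'm) homotopy_prob_space_scheme \<Rightarrow> bool" where
  "contractible V \<longleftrightarrow> quasi_isomorphism V ground_complex (expect V)"

text \<open>
  The second map of the factorization \<open>V \<rightarrow> CV \<rightarrow> \<complex>\<close> is \<open>expect CV\<close>; that the composite is
  \<open>expect V\<close> is the last clause of \<^const>\<open>prob_morphism\<close>.
\<close>

definition is_cone ::
  "('a::ab_group_add, 'm) homotopy_prob_space_scheme \<Rightarrow>
   ('b::ab_group_add, 'k) homotopy_prob_space_scheme \<Rightarrow> (int \<Rightarrow> 'a \<Rightarrow> 'b) \<Rightarrow> bool" where
  "is_cone V CV f \<longleftrightarrow>
     is_prob_space CV \<and> contractible CV \<and>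
     prob_morphism V CV f \<and> (\<forall>n. inj_on (f n) (comp V n))"

definition is_algebraic_cone ::
  "('a::ab_group_add, 'm) homotopy_prob_space_scheme \<Rightarrow>
   ('b::ab_group_add, 'k) homotopy_prob_space_scheme \<Rightarrow> (int \<Rightarrow> 'a \<Rightarrow> 'b) \<Rightarrow> bool" where
  "is_algebraic_cone V CV f \<longleftrightarrow>
     is_cone V CV f \<and>
     (\<forall>i j. \<forall>x\<in>comp V i. \<forall>y\<in>comp V j.
        f (i + j) (mul V i j x y) = mul CV i j (f i x) (f j y))"

end

theory Submission imports Defs begin

text \<open>
  Write \<open>q = \<upsilon>e\<close> and \<open>p = 1 - q\<close>. Because \<open>e\<upsilon> = 1\<close>, these are complementary idempotent chain
  maps on \<open>V\<close>: \<open>q\<close> projects to the constants \<open>\<complex>1\<close>, and \<open>p\<close> to the mean-zero elements \<open>K = ker e\<close>.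
  To make \<open>e\<close> a quasi-isomorphism one has to kill the cohomology of \<open>K\<close>. As complexes,
  \<open>V \<oplus> K[1]\<close> would do, but the product must extend to the new elements, and \<open>K\<close> is in general not
  closed under multiplication by \<open>V\<close>.

  The remedy is to add only copies of \<open>V\<close> itself, which are modules over \<open>V\<close>. A first copy \<open>V[1]\<close>
  kills \<open>K\<close> through \<open>p\<close>, but brings in the new kernel \<open>\<complex>1\<close>; a second copy kills that through
  \<open>q\<close>, bringing in \<open>K\<close>, and so on. The result is the total complex of the double complex
  \<open>\<dots> \<rightarrow> V \<rightarrow> V \<rightarrow> V \<rightarrow> V\<close>
  whose horizontal maps alternate between \<open>p\<close> and \<open>q\<close>, ending with \<open>p\<close>; an element of it is a
  sequence in \<open>V\<close>. Its rows split: the sum \<open>p + q = 1\<close> gives an explicit contraction onto the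
  constants in column 0 (lemma \<open>cone_homotopy\<close>), and infinite sequences cause no trouble for it.

  The product is that of the square-zero extension of \<open>V\<close> (column 0) by the \<open>V\<close>-module formed by
  the other columns. It need not be compatible with the differential, so only the axioms of
  a graded commutative algebra are at stake, and they are inherited from \<open>V\<close>.
\<close>

section \<open>Linear maps between subspaces\<close>

lemma linear_betweenD:
  assumes "linear_between s A t B f"
  shows "x \<in> A \<Longrightarrow> f x \<in> B"
    and "x \<in> A \<Longrightarrow> y \<in> A \<Longrightarrow> f (x + y) = f x + f y"
    and "x \<in> A \<Longrightarrow> f (s c x) = t c (f x)"
  using assms by (auto simp: linear_between_def)

lemma linear_between_zero:
  assumes "linear_between s A t B f" "0 \<in> A"
  shows "f 0 = 0"
  using linear_betweenD(2)[OF assms(1) assms(2) assms(2)] by simp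

lemma linear_between_minus:
  assumes f: "linear_between s A t B f"
    and s: "vector_space s" and A: "module.subspace s A" and x: "x \<in> A" and y: "y \<in> A"
  shows "f (x - y) = f x - f y"
proof -
  interpret s: vector_space s by fact
  have "f (x - y + y) = f (x - y) + f y"
    by (rule linear_betweenD(2)[OF f]) (use A x y s.subspace_diff in auto)
  then show ?thesis by simp
qed

section \<open>A criterion for quasi-isomorphisms\<close>

lemma equiv_cohomologous:
  assumes "is_complex V"
  shows "equiv (cocycles V n) (cohomologous V n)"
proof -
  interpret vector_space "scal V" using assms by (simp add: is_complex_def)
  have sub: "\<And>m. subspace (comp V m)"
    and d: "\<And>m. linear_between (scal V) (comp V m) (scal V) (comp V (m + 1)) (diff V m)"
    using assms by (auto simp: is_complex_def)
  have add: "x + y \<in> coboundaries V n"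
    if "x \<in> coboundaries V n" "y \<in> coboundaries V n" for x y
    using that subspace_add[OF sub] unfolding coboundaries_def
    by (smt (verit) image_iff linear_betweenD(2)[OF d])
  have neg: "- x \<in> coboundaries V n" if x: "x \<in> coboundaries V n" for x
  proof -
    obtain w where w: "w \<in> comp V (n - 1)" "x = diff V (n - 1) w"
      using x by (auto simp: coboundaries_def)
    have "diff V (n - 1) (0 - w) = 0 - x"
      using w linear_between_minus[OF d _ sub subspace_0[OF sub] w(1)]
        linear_between_zero[OF d subspace_0[OF sub]] vector_space_axioms by simp
    then show ?thesis
      using subspace_diff[OF sub subspace_0[OF sub] w(1)]
      by (auto simp: coboundaries_def image_iff intro!: bexI[of _ "0 - w"])
  qed
  have zero: "0 \<in> coboundaries V n"
    using linear_between_zero[OF d subspace_0[OF sub]] subspace_0[OF sub]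
    unfolding coboundaries_def by (metis image_eqI)
  show ?thesis
  proof (rule equivI)
    show "cohomologous V n \<subseteq> cocycles V n \<times> cocycles V n"
      by (auto simp: cohomologous_def)
    show "refl_on (cocycles V n) (cohomologous V n)"
      using zero by (auto simp: refl_on_def cohomologous_def)
    show "sym (cohomologous V n)"
      using neg by (force simp: sym_def cohomologous_def)
    show "trans (cohomologous V n)"
      unfolding trans_def cohomologous_def using add by (force dest: add)
  qed
qed

text \<open>
  The class of \<open>x\<close> is recovered from the class of \<open>f n x\<close> by applying the section \<open>g\<close>, because \<open>x\<close>
  and \<open>g n (f n x)\<close> are cohomologous; so \<open>g\<close> induces the inverse of \<open>f\<close> on cohomology.
\<close>

lemma quasi_isomorphism_if_section:
  fixes V :: "('a::ab_group_add, 'm) cochain_complex_scheme"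
    and W :: "('b::ab_group_add, 'k) cochain_complex_scheme"
  assumes V: "is_complex V" and W: "is_complex W"
    and f: "chain_map V W f" and g: "chain_map W V g"
    and fg: "\<And>n y. y \<in> comp W n \<Longrightarrow> f n (g n y) = y"
    and gf: "\<And>n x. x \<in> cocycles V n \<Longrightarrow> x - g n (f n x) \<in> coboundaries V n"
  shows "quasi_isomorphism V W f"
  unfolding quasi_isomorphism_def
proof (intro conjI allI f)
  fix n
  have cocycle_map: "h n x \<in> cocycles B n"
    if h: "chain_map A B h" and "is_complex A" "is_complex B" and x: "x \<in> cocycles A n"
    for A :: "('c::ab_group_add, 'p) cochain_complex_scheme"
      and B :: "('d::ab_group_add, 'q) cochain_complex_scheme" and h x
  proof -
    have l: "linear_between (scal A) (comp A m) (scal B) (comp B m) (h m)" for m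
      using h by (simp add: chain_map_def)
    have "0 \<in> comp A (n + 1)"
      using \<open>is_complex A\<close> by (auto simp: is_complex_def module_iff_vector_space module.subspace_def)
    then show ?thesis
      using h x linear_between_zero[OF l] linear_betweenD(1)[OF l]
      unfolding cocycles_def chain_map_def by force
  qed
  have cohomologous_map: "(h n x, h n y) \<in> cohomologous B n"
    if h: "chain_map A B h" and A: "is_complex A" and B: "is_complex B"
      and xy: "(x, y) \<in> cohomologous A n"
    for A :: "('c::ab_group_add, 'p) cochain_complex_scheme"
      and B :: "('d::ab_group_add, 'q) cochain_complex_scheme" and h x y
  proof -
    have l: "linear_between (scal A) (comp A m) (scal B) (comp B m) (h m)" for m
      using h by (simp add: chain_map_def)
    have x: "x \<in> cocycles A n" and y: "y \<in> cocycles A n"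
      using xy by (auto simp: cohomologous_def)
    obtain w where w: "w \<in> comp A (n - 1)" "x - y = diff A (n - 1) w"
      using xy by (auto simp: cohomologous_def coboundaries_def)
    have "h n x - h n y = h n (x - y)"
      using linear_between_minus[OF l, of n x y] A x y by (simp add: is_complex_def cocycles_def)
    also have "\<dots> = diff B (n - 1) (h (n - 1) w)"
      using h w by (force simp: chain_map_def)
    finally show ?thesis
      using cocycle_map[OF h A B x] cocycle_map[OF h A B y] linear_betweenD(1)[OF l w(1)]
      by (auto simp: cohomologous_def coboundaries_def)
  qed
  note eqV = equiv_cohomologous[OF V, of n] and eqW = equiv_cohomologous[OF W, of n]
  have on_class: "cohomology_map W f n (cohomologous V n `` {x}) = cohomologous W n `` {f n x}"
    if x: "x \<in> cocycles V n" for x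
  proof -
    have "(x, x) \<in> cohomologous V n" using eqV x by (meson equivE refl_onD)
    then show ?thesis
      unfolding cohomology_map_def
      using cohomologous_map[OF f V W] eqW
      by (auto simp: Image_iff) (meson equivE symD transD)+
  qed
  show "bij_betw (cohomology_map W f n) (cohomology V n) (cohomology W n)"
  proof (rule bij_betw_imageI)
    show "inj_on (cohomology_map W f n) (cohomology V n)"
    proof (rule inj_onI)
      fix X Y assume X: "X \<in> cohomology V n" and Y: "Y \<in> cohomology V n"
        and eq: "cohomology_map W f n X = cohomology_map W f n Y"
      obtain x y where x: "x \<in> cocycles V n" "X = cohomologous V n `` {x}"
        and y: "y \<in> cocycles V n" "Y = cohomologous V n `` {y}"
        using X Y by (auto simp: cohomology_def elim!: quotientE)
      have "cohomologous W n `` {f n x} = cohomologous W n `` {f n y}"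
        using eq on_class x y by simp
      then have "(f n x, f n y) \<in> cohomologous W n"
        using eq_equiv_class[OF _ eqW cocycle_map[OF f V W y(1)]] by blast
      then have "(g n (f n x), g n (f n y)) \<in> cohomologous V n"
        by (rule cohomologous_map[OF g W V])
      moreover have "(z, g n (f n z)) \<in> cohomologous V n" if "z \<in> cocycles V n" for z
        using gf[OF that] that cocycle_map[OF g W V cocycle_map[OF f V W that]]
        by (simp add: cohomologous_def)
      ultimately have "(x, y) \<in> cohomologous V n"
        using eqV x y by (meson equivE symD transD)
      then show "X = Y"
        using x y equiv_class_eq[OF eqV] by simp
    qed
    show "cohomology_map W f n ` cohomology V n = cohomology W n"
    proof (intro equalityI subsetI)
      fix Y assume "Y \<in> cohomology_map W f n ` cohomology V n"
      then show "Y \<in> cohomology W n"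
        using on_class cocycle_map[OF f V W]
        by (auto simp: cohomology_def intro!: quotientI elim!: quotientE)
    next
      fix Y assume "Y \<in> cohomology W n"
      then obtain y where y: "y \<in> cocycles W n" "Y = cohomologous W n `` {y}"
        by (auto simp: cohomology_def elim!: quotientE)
      have "g n y \<in> cocycles V n" by (rule cocycle_map[OF g W V y(1)])
      moreover have "f n (g n y) = y" using fg y by (simp add: cocycles_def)
      ultimately show "Y \<in> cohomology_map W f n ` cohomology V n"
        using y on_class[of "g n y"]
        by (auto simp: cohomology_def quotientI image_iff
            intro!: bexI[of _ "cohomologous V n `` {g n y}"])
    qed
  qed
qed

lemma is_complex_ground: "is_complex ground_complex"
proof -
  interpret vector_space "(*) :: complex \<Rightarrow> complex \<Rightarrow> complex"
    by unfold_locales (auto simp: algebra_simps)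
  show ?thesis
    unfolding is_complex_def ground_complex_def
    using vector_space_axioms
    by (auto simp: subspace_def linear_between_def)
qed

section \<open>The splitting of a probability space into constants and mean-zero elements\<close>

definition mean_part :: "('a::ab_group_add, 'm) homotopy_prob_space_scheme \<Rightarrow> int \<Rightarrow> 'a \<Rightarrow> 'a" where
  "mean_part V n x = unit_map V n (expect V n x)"

text \<open>
  The horizontal map of the double complex from column \<open>k + 1\<close> to column \<open>k\<close>. It starts with the
  projection to mean-zero elements at \<open>k = 0\<close>, so that the constants of column 0 survive.
\<close>

definition row_map ::
  "('a::ab_group_add, 'm) homotopy_prob_space_scheme \<Rightarrow> nat \<Rightarrow> int \<Rightarrow> 'a \<Rightarrow> 'a" where
  "row_map V k n x = (if even k then x - mean_part V n x else mean_part V n x)"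

locale prob_space_facts =
  fixes V :: "('a::ab_group_add, 'm) homotopy_prob_space_scheme"
  assumes prob: "is_prob_space V"
begin

sublocale vs: vector_space "scal V"
  using prob by (simp add: is_prob_space_def is_complex_def)

lemma subspace_comp: "vs.subspace (comp V n)"
  and linear_diff: "linear_between (scal V) (comp V n) (scal V) (comp V (n + 1)) (diff V n)"
  and linear_unit: "linear_between (*) (comp ground_complex n) (scal V) (comp V n) (unit_map V n)"
  and linear_expect: "linear_between (scal V) (comp V n) (*) (comp ground_complex n) (expect V n)"
  and linear_mul_right: "x \<in> comp V i \<Longrightarrow>
    linear_between (scal V) (comp V j) (scal V) (comp V (i + j)) (\<lambda>y. mul V i j x y)"
  and linear_mul_left: "y \<in> comp V j \<Longrightarrow>
    linear_between (scal V) (comp V i) (scal V) (comp V (i + j)) (\<lambda>x. mul V i j x y)"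
  using prob
  by (auto simp: is_prob_space_def is_complex_def chain_map_def graded_comm_algebra_def
      ground_complex_def)

lemma comp_zero [simp]: "0 \<in> comp V n"
  and comp_add: "x \<in> comp V n \<Longrightarrow> y \<in> comp V n \<Longrightarrow> x + y \<in> comp V n"
  and comp_minus: "x \<in> comp V n \<Longrightarrow> y \<in> comp V n \<Longrightarrow> x - y \<in> comp V n"
  and comp_scale: "x \<in> comp V n \<Longrightarrow> scal V c x \<in> comp V n"
  using subspace_comp vs.subspace_0 vs.subspace_add vs.subspace_diff vs.subspace_scale by blast+

lemmas diff_mem = linear_betweenD(1)[OF linear_diff]
  and diff_add = linear_betweenD(2)[OF linear_diff]
  and diff_scale = linear_betweenD(3)[OF linear_diff]
  and diff_minus = linear_between_minus[OF linear_diff vs.vector_space_axioms subspace_comp]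

lemma diff_zero [simp]: "diff V n 0 = 0"
  by (rule linear_between_zero[OF linear_diff comp_zero])

lemma diff_diff: "x \<in> comp V n \<Longrightarrow> diff V (n + 1) (diff V n x) = 0"
  using prob by (simp add: is_prob_space_def is_complex_def)

lemmas mul_mem = linear_betweenD(1)[OF linear_mul_right]
  and mul_add_right = linear_betweenD(2)[OF linear_mul_right]
  and mul_scale_right = linear_betweenD(3)[OF linear_mul_right]
  and mul_add_left = linear_betweenD(2)[OF linear_mul_left]
  and mul_scale_left = linear_betweenD(3)[OF linear_mul_left]

lemma mul_zero_right [simp]: "x \<in> comp V i \<Longrightarrow> mul V i j x 0 = 0"
  by (rule linear_between_zero[OF linear_mul_right comp_zero])

lemma mul_zero_left [simp]: "y \<in> comp V j \<Longrightarrow> mul V i j 0 y = 0"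
  by (rule linear_between_zero[OF linear_mul_left comp_zero])

lemma mul_assoc:
  "x \<in> comp V i \<Longrightarrow> y \<in> comp V j \<Longrightarrow> z \<in> comp V k \<Longrightarrow>
    mul V (i + j) k (mul V i j x y) z = mul V i (j + k) x (mul V j k y z)"
  and mul_comm:
  "x \<in> comp V i \<Longrightarrow> y \<in> comp V j \<Longrightarrow>
    mul V i j x y = scal V ((-1) powi (i * j)) (mul V j i y x)"
  and mul_unit_left: "x \<in> comp V i \<Longrightarrow> mul V 0 i (unit_map V 0 1) x = x"
  and mul_unit_right: "x \<in> comp V i \<Longrightarrow> mul V i 0 x (unit_map V 0 1) = x"
  using prob unfolding is_prob_space_def graded_comm_algebra_def by blast+

lemma zero_in_ground [simp]: "0 \<in> comp ground_complex n"
  by (simp add: ground_complex_def)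

lemma unit_zero [simp]: "unit_map V n 0 = 0"
  by (rule linear_between_zero[OF linear_unit zero_in_ground])

lemma expect_zero [simp]: "expect V n 0 = 0"
  by (rule linear_between_zero[OF linear_expect comp_zero])

lemma expect_mem: "x \<in> comp V n \<Longrightarrow> expect V n x \<in> comp ground_complex n"
  by (rule linear_betweenD(1)[OF linear_expect])

lemma unit_mem: "c \<in> comp ground_complex n \<Longrightarrow> unit_map V n c \<in> comp V n"
  by (rule linear_betweenD(1)[OF linear_unit])

lemma expect_unit: "c \<in> comp ground_complex n \<Longrightarrow> expect V n (unit_map V n c) = c"
  using prob by (simp add: is_prob_space_def)

lemma diff_unit: "c \<in> comp ground_complex n \<Longrightarrow> diff V n (unit_map V n c) = 0"
  using prob unit_zero[of "n + 1"]
  by (auto simp: is_prob_space_def chain_map_def ground_complex_def)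

lemma expect_diff: "x \<in> comp V n \<Longrightarrow> expect V (n + 1) (diff V n x) = 0"
  using prob by (auto simp: is_prob_space_def chain_map_def ground_complex_def)

lemma linear_mean_part: "linear_between (scal V) (comp V n) (scal V) (comp V n) (mean_part V n)"
  using linear_unit[of n] linear_expect[of n]
  by (fastforce simp: linear_between_def mean_part_def)

lemma linear_row_map: "linear_between (scal V) (comp V n) (scal V) (comp V n) (row_map V k n)"
  unfolding linear_between_def
  by (auto simp: row_map_def vs.scale_right_diff_distrib linear_betweenD[OF linear_mean_part]
      intro!: comp_minus)

lemmas row_mem = linear_betweenD(1)[OF linear_row_map]
  and row_add = linear_betweenD(2)[OF linear_row_map]
  and row_scale = linear_betweenD(3)[OF linear_row_map]

lemma row_zero [simp]: "row_map V k n 0 = 0"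
  by (rule linear_between_zero[OF linear_row_map comp_zero])

lemma mean_part_mem: "x \<in> comp V n \<Longrightarrow> mean_part V n x \<in> comp V n"
  by (rule linear_betweenD(1)[OF linear_mean_part])

lemma mean_part_idem: "x \<in> comp V n \<Longrightarrow> mean_part V n (mean_part V n x) = mean_part V n x"
  by (simp add: mean_part_def expect_unit expect_mem)

lemmas mean_part_minus =
  linear_between_minus[OF linear_mean_part vs.vector_space_axioms subspace_comp]

lemma row_idem: "x \<in> comp V n \<Longrightarrow> row_map V k n (row_map V k n x) = row_map V k n x"
  by (simp add: row_map_def mean_part_minus mean_part_mem mean_part_idem)

lemma row_row_Suc: "x \<in> comp V n \<Longrightarrow> row_map V k n (row_map V (Suc k) n x) = 0"
  by (simp add: row_map_def mean_part_minus mean_part_mem mean_part_idem)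

lemma row_add_row_Suc: "row_map V k n x + row_map V (Suc k) n x = x"
  by (simp add: row_map_def)

text \<open>
  Both composites of the differential with \<^const>\<open>mean_part\<close> vanish, since \<open>\<complex>\<close> has zero
  differential; hence each projection is a chain map.
\<close>

lemma row_diff: "x \<in> comp V n \<Longrightarrow> row_map V k (n + 1) (diff V n x) = diff V n (row_map V k n x)"
  by (simp add: row_map_def mean_part_def expect_diff diff_minus diff_unit expect_mem unit_mem)

lemma expect_row_0: "x \<in> comp V n \<Longrightarrow> expect V n (row_map V 0 n x) = 0"
  using linear_between_minus[OF linear_expect vs.vector_space_axioms subspace_comp, of x n
      "mean_part V n x"]
  by (simp add: row_map_def mean_part_mem) (simp add: mean_part_def expect_unit expect_mem)

end

section \<open>Differential and product on sequences\<close>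

text \<open>
  The total differential. The horizontal maps commute with the differential of \<open>V\<close>; the sign in
  column \<open>k\<close> makes them anticommute.
\<close>

definition cone_diff ::
  "('a::ab_group_add, 'm) homotopy_prob_space_scheme \<Rightarrow> int \<Rightarrow> (nat \<Rightarrow> 'a) \<Rightarrow> nat \<Rightarrow> 'a" where
  "cone_diff V n s k =
     scal V ((-1) ^ k) (diff V (n + int k) (s k)) + row_map V k (n + int (Suc k)) (s (Suc k))"

text \<open>
  The product of the square-zero extension: products of two elements outside column 0 vanish. An
  entry \<open>x\<close> of column \<open>k\<close> stands for \<open>x \<epsilon>\<^sub>k\<close> with a formal symbol \<open>\<epsilon>\<^sub>k\<close> of degree \<open>-k\<close>, and the sign
  arises from moving \<open>\<epsilon>\<^sub>k\<close> to the right past an element of degree \<open>j\<close>.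
\<close>

definition cone_mul ::
  "('a::ab_group_add, 'm) homotopy_prob_space_scheme \<Rightarrow> int \<Rightarrow> int \<Rightarrow>
   (nat \<Rightarrow> 'a) \<Rightarrow> (nat \<Rightarrow> 'a) \<Rightarrow> nat \<Rightarrow> 'a" where
  "cone_mul V i j s t k =
     (if k = 0 then mul V i j (s 0) (t 0)
      else mul V i (j + int k) (s 0) (t k) +
        scal V ((-1) powi (int k * j)) (mul V (i + int k) j (s k) (t 0)))"

definition in_column_0 :: "'a::zero \<Rightarrow> nat \<Rightarrow> 'a" where
  "in_column_0 x k = (if k = 0 then x else 0)"

definition row_cone ::
  "('a::ab_group_add, 'm) homotopy_prob_space_scheme \<Rightarrow> (nat \<Rightarrow> 'a) homotopy_prob_space" where
  "row_cone V =
     \<lparr>scal = (\<lambda>c s k. scal V c (s k)),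
      comp = (\<lambda>n. {s. \<forall>k. s k \<in> comp V (n + int k)}),
      diff = cone_diff V,
      unit_map = (\<lambda>n c. in_column_0 (unit_map V n c)),
      mul = cone_mul V,
      expect = (\<lambda>n s. expect V n (s 0))\<rparr>"

context prob_space_facts
begin

subsection \<open>The underlying complex and its structure maps\<close>

lemma row_cone_compD: "s \<in> comp (row_cone V) n \<Longrightarrow> s k \<in> comp V (n + int k)"
  by (simp add: row_cone_def)

lemma row_cone_comp0: "s \<in> comp (row_cone V) n \<Longrightarrow> s 0 \<in> comp V n"
  using row_cone_compD[of s n 0] by simp

lemma row_cone_compI: "(\<And>k. s k \<in> comp V (n + int k)) \<Longrightarrow> s \<in> comp (row_cone V) n"
  by (simp add: row_cone_def)

lemma row_cone_simps:
  "scal (row_cone V) c s = (\<lambda>k. scal V c (s k))"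
  "diff (row_cone V) = cone_diff V"
  "unit_map (row_cone V) n c = in_column_0 (unit_map V n c)"
  "mul (row_cone V) = cone_mul V"
  "expect (row_cone V) n s = expect V n (s 0)"
  by (simp_all add: row_cone_def)

lemma row_cone_vector_space: "vector_space (scal (row_cone V))"
  by unfold_locales (auto simp: row_cone_def fun_eq_iff vs.scale_right_distrib vs.scale_left_distrib)

lemma row_cone_subspace: "module.subspace (scal (row_cone V)) (comp (row_cone V) n)"
proof -
  interpret c: vector_space "scal (row_cone V)" by (rule row_cone_vector_space)
  show ?thesis
    by (auto simp: c.subspace_def intro!: row_cone_compI comp_add comp_scale dest: row_cone_compD)
      (auto simp: row_cone_simps intro!: row_cone_compI comp_scale dest: row_cone_compD)
qed

lemma cone_diff_mem:
  assumes s: "s \<in> comp (row_cone V) n"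
  shows "cone_diff V n s \<in> comp (row_cone V) (n + 1)"
proof (rule row_cone_compI)
  fix k
  have "diff V (n + int k) (s k) \<in> comp V (n + 1 + int k)"
    using diff_mem[OF row_cone_compD[OF s, of k]] by (simp add: ac_simps)
  moreover have "row_map V k (n + int (Suc k)) (s (Suc k)) \<in> comp V (n + 1 + int k)"
    using row_mem[OF row_cone_compD[OF s, of "Suc k"], of k] by (simp add: ac_simps)
  ultimately show "cone_diff V n s k \<in> comp V (n + 1 + int k)"
    unfolding cone_diff_def by (intro comp_add comp_scale)
qed

lemma linear_cone_diff:
  "linear_between (scal (row_cone V)) (comp (row_cone V) n)
     (scal (row_cone V)) (comp (row_cone V) (n + 1)) (diff (row_cone V) n)"
proof -
  have "cone_diff V n (s + t) = cone_diff V n s + cone_diff V n t"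
    if "s \<in> comp (row_cone V) n" "t \<in> comp (row_cone V) n" for s t
    using that[THEN row_cone_compD]
    by (simp add: fun_eq_iff cone_diff_def diff_add row_add vs.scale_right_distrib del: of_nat_Suc)
  moreover have "cone_diff V n (\<lambda>k. scal V c (s k)) = (\<lambda>k. scal V c (cone_diff V n s k))"
    if "s \<in> comp (row_cone V) n" for s c
    using that[THEN row_cone_compD]
    by (simp add: fun_eq_iff cone_diff_def diff_scale row_scale vs.scale_right_distrib mult.commute
        del: of_nat_Suc)
  ultimately show ?thesis
    by (simp add: linear_between_def row_cone_simps cone_diff_mem)
qed

lemma cone_diff_cone_diff:
  assumes s: "s \<in> comp (row_cone V) n"
  shows "cone_diff V (n + 1) (cone_diff V n s) = 0"
proof (rule ext)
  fix k
  define m where "m = n + int k"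
  let ?e = "(-1) ^ k :: complex"
  have ix: "n + int k = m" "n + 1 + int k = m + 1" "n + int (Suc k) = m + 1"
    "n + 1 + int (Suc k) = m + 2" "n + int (Suc (Suc k)) = m + 2" by (simp_all add: m_def)
  have mems: "s k \<in> comp V m" "s (Suc k) \<in> comp V (m + 1)" "s (Suc (Suc k)) \<in> comp V (m + 2)"
    using row_cone_compD[OF s, of k] row_cone_compD[OF s, of "Suc k"]
      row_cone_compD[OF s, of "Suc (Suc k)"]
    by (simp_all only: ix)
  have d: "diff V m (s k) \<in> comp V (m + 1)" "diff V (m + 1) (s (Suc k)) \<in> comp V (m + 2)"
    using diff_mem[OF mems(1)] diff_mem[OF mems(2)] by (simp_all add: add.assoc)
  have rd: "row_map V k (m + 2) (diff V (m + 1) (s (Suc k))) =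
      diff V (m + 1) (row_map V k (m + 1) (s (Suc k)))"
    using row_diff[OF mems(2), of k] by (simp add: add.assoc)
  have "diff V (m + 1) (cone_diff V n s k) = diff V (m + 1) (row_map V k (m + 1) (s (Suc k)))"
    unfolding cone_diff_def ix
    by (simp add: diff_add diff_scale d comp_scale row_mem mems diff_diff)
  moreover have "row_map V k (m + 2) (cone_diff V n s (Suc k)) =
      scal V (- ?e) (diff V (m + 1) (row_map V k (m + 1) (s (Suc k))))"
    unfolding cone_diff_def ix
    by (simp add: row_add row_scale d comp_scale row_mem mems row_row_Suc rd
        del: vs.scale_minus_left)
  \<comment> \<open>The two mixed terms cancel because of the sign, and the two pure terms are zero.\<close>
  ultimately show "cone_diff V (n + 1) (cone_diff V n s) k = 0 k"
    unfolding cone_diff_def[of V "n + 1"] ix by simp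
qed

lemma is_complex_row_cone: "is_complex (row_cone V)"
  unfolding is_complex_def
  using row_cone_vector_space row_cone_subspace linear_cone_diff cone_diff_cone_diff
  by (simp add: row_cone_simps)

lemma in_column_0_mem: "x \<in> comp V n \<Longrightarrow> in_column_0 x \<in> comp (row_cone V) n"
  by (rule row_cone_compI) (simp add: in_column_0_def)

lemma in_column_0_add: "in_column_0 (x + y) = in_column_0 x + (in_column_0 y :: nat \<Rightarrow> 'a)"
  by (simp add: in_column_0_def fun_eq_iff)

lemma in_column_0_scale: "in_column_0 (scal V c x) = scal (row_cone V) c (in_column_0 x)"
  by (simp add: in_column_0_def fun_eq_iff row_cone_simps)

lemma cone_diff_in_column_0: "cone_diff V n (in_column_0 x) = in_column_0 (diff V n x)"
  by (auto simp: fun_eq_iff cone_diff_def in_column_0_def)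

lemma chain_map_in_column_0: "chain_map V (row_cone V) (\<lambda>n. in_column_0)"
  unfolding chain_map_def linear_between_def
  by (simp add: in_column_0_mem in_column_0_add in_column_0_scale row_cone_simps(2)
      cone_diff_in_column_0)

lemma chain_map_unit_row_cone: "chain_map ground_complex (row_cone V) (unit_map (row_cone V))"
proof -
  have "linear_between (*) (comp ground_complex n) (scal (row_cone V)) (comp (row_cone V) n)
      (unit_map (row_cone V) n)" for n
    unfolding linear_between_def
    by (auto simp: row_cone_simps(3) linear_betweenD[OF linear_unit] in_column_0_add
        in_column_0_scale intro!: in_column_0_mem unit_mem)
  then show ?thesis
    by (auto simp: chain_map_def row_cone_simps(2,3) cone_diff_in_column_0 diff_unit)
      (auto simp: ground_complex_def in_column_0_def fun_eq_iff cone_diff_in_column_0)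
qed

lemma chain_map_expect_row_cone: "chain_map (row_cone V) ground_complex (expect (row_cone V))"
proof -
  have "expect V (n + 1) (cone_diff V n s 0) = 0" if s: "s \<in> comp (row_cone V) n" for n s
    using row_cone_comp0[OF s] row_cone_compD[OF s, of 1]
      linear_betweenD(2)[OF linear_expect, of "diff V n (s 0)" "n + 1" "row_map V 0 (n + 1) (s 1)"]
    by (simp add: cone_diff_def expect_diff expect_row_0 row_mem diff_mem)
  moreover have "linear_between (scal (row_cone V)) (comp (row_cone V) n) (*)
      (comp ground_complex n) (expect (row_cone V) n)" for n
    unfolding linear_between_def
    by (auto simp: row_cone_simps linear_betweenD[OF linear_expect] row_cone_comp0
        intro!: expect_mem)
  ultimately show ?thesis
    by (simp add: chain_map_def row_cone_simps ground_complex_def)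
qed

subsection \<open>Contractibility\<close>

definition cone_homotopy :: "int \<Rightarrow> (nat \<Rightarrow> 'a) \<Rightarrow> nat \<Rightarrow> 'a" where
  "cone_homotopy n s k = (case k of 0 \<Rightarrow> 0 | Suc j \<Rightarrow> row_map V j (n + int j) (s j))"

lemma cone_homotopy_mem:
  assumes s: "s \<in> comp (row_cone V) n"
  shows "cone_homotopy n s \<in> comp (row_cone V) (n - 1)"
proof (rule row_cone_compI)
  show "cone_homotopy n s k \<in> comp V (n - 1 + int k)" for k
    using row_mem[OF row_cone_compD[OF s]] by (cases k) (simp_all add: cone_homotopy_def)
qed

text \<open>
  Each horizontal map is idempotent and complementary to the next one. In column \<open>k + 1\<close> the two
  summands on the left therefore contribute the projections number \<open>k + 1\<close> and \<open>k\<close> of \<open>s (k + 1)\<close>,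
  which add up to it, while the terms with the differential of \<open>V\<close> cancel. In column 0 only the
  projection to mean-zero elements occurs, and the constants are left over.
\<close>

lemma cone_homotopy:
  assumes s: "s \<in> comp (row_cone V) n"
  shows "cone_diff V (n - 1) (cone_homotopy n s) + cone_homotopy (n + 1) (cone_diff V n s) =
    s - in_column_0 (mean_part V n (s 0))"
proof (rule ext)
  fix k
  show "(cone_diff V (n - 1) (cone_homotopy n s) + cone_homotopy (n + 1) (cone_diff V n s)) k =
    (s - in_column_0 (mean_part V n (s 0))) k"
  proof (cases k)
    case 0
    then show ?thesis
      using row_idem[OF row_cone_comp0[OF s], of 0]
      by (simp add: cone_diff_def cone_homotopy_def in_column_0_def) (simp add: row_map_def)
  next
    case (Suc j)
    define m where "m = n + int j"
    let ?e = "(-1) ^ j :: complex"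
    have ix: "n - 1 + int (Suc j) = m" "n - 1 + int (Suc (Suc j)) = m + 1" "n + int j = m"
      "n + 1 + int j = m + 1" "n + int (Suc j) = m + 1" by (simp_all add: m_def)
    have mems: "s j \<in> comp V m" "s (Suc j) \<in> comp V (m + 1)"
      using row_cone_compD[OF s, of j] row_cone_compD[OF s, of "Suc j"]
      by (simp_all only: ix)
    have "cone_diff V (n - 1) (cone_homotopy n s) (Suc j) =
        scal V (- ?e) (diff V m (row_map V j m (s j))) + row_map V (Suc j) (m + 1) (s (Suc j))"
      unfolding cone_diff_def cone_homotopy_def nat.case ix
      by (simp add: row_idem mems)
    moreover have "cone_homotopy (n + 1) (cone_diff V n s) (Suc j) =
        scal V ?e (diff V m (row_map V j m (s j))) + row_map V j (m + 1) (s (Suc j))"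
      unfolding cone_homotopy_def cone_diff_def nat.case ix
      using row_diff[OF mems(1), of j]
      by (simp add: row_add row_scale row_idem mems comp_scale diff_mem row_mem)
    ultimately show ?thesis
      using Suc row_add_row_Suc[of j "m + 1" "s (Suc j)"]
      by (simp add: in_column_0_def add.commute)
  qed
qed

lemma contractible_row_cone: "contractible (row_cone V)"
  unfolding contractible_def
proof (rule quasi_isomorphism_if_section)
  show "expect (row_cone V) n (unit_map (row_cone V) n c) = c"
    if "c \<in> comp ground_complex n" for n c
    using that by (simp add: row_cone_simps in_column_0_def expect_unit)
  show "s - unit_map (row_cone V) n (expect (row_cone V) n s) \<in> coboundaries (row_cone V) n"
    if s: "s \<in> cocycles (row_cone V) n" for n s
  proof -
    have sc: "s \<in> comp (row_cone V) n" and ds: "cone_diff V n s = 0"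
      using s by (simp_all add: cocycles_def row_cone_simps)
    have "cone_homotopy (n + 1) (cone_diff V n s) = 0"
      unfolding ds by (auto simp: cone_homotopy_def fun_eq_iff split: nat.split)
    then have "s - in_column_0 (mean_part V n (s 0)) = cone_diff V (n - 1) (cone_homotopy n s)"
      using cone_homotopy[OF sc] by simp
    then show ?thesis
      using cone_homotopy_mem[OF sc]
      by (auto simp: coboundaries_def row_cone_simps mean_part_def)
  qed
qed (rule is_complex_row_cone is_complex_ground chain_map_expect_row_cone
    chain_map_unit_row_cone)+

subsection \<open>The algebra structure\<close>

lemma cone_mul_terms_mem:
  assumes "s \<in> comp (row_cone V) i" "t \<in> comp (row_cone V) j"
  shows "mul V i (j + int k) (s 0) (t k) \<in> comp V (i + j + int k)"
    and "mul V (i + int k) j (s k) (t 0) \<in> comp V (i + j + int k)"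
  using mul_mem[OF row_cone_comp0[OF assms(1)] row_cone_compD[OF assms(2), of k]]
    mul_mem[OF row_cone_compD[OF assms(1), of k] row_cone_comp0[OF assms(2)]]
  by (simp_all add: ac_simps)

lemma cone_mul_mem:
  assumes "s \<in> comp (row_cone V) i" "t \<in> comp (row_cone V) j"
  shows "cone_mul V i j s t \<in> comp (row_cone V) (i + j)"
proof (rule row_cone_compI)
  show "cone_mul V i j s t k \<in> comp V (i + j + int k)" for k
    using cone_mul_terms_mem[OF assms, of k]
    by (auto simp: cone_mul_def intro!: comp_add comp_scale)
qed

lemma cone_mul_linear_right:
  assumes s: "s \<in> comp (row_cone V) i"
  shows "linear_between (scal (row_cone V)) (comp (row_cone V) j)
     (scal (row_cone V)) (comp (row_cone V) (i + j)) (\<lambda>t. mul (row_cone V) i j s t)"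
proof -
  note S = row_cone_comp0[OF s] row_cone_compD[OF s]
  have "cone_mul V i j s (t + u) = cone_mul V i j s t + cone_mul V i j s u"
    if t: "t \<in> comp (row_cone V) j" and u: "u \<in> comp (row_cone V) j" for t u
    using S t[THEN row_cone_compD] u[THEN row_cone_compD] t[THEN row_cone_comp0] u[THEN row_cone_comp0]
    by (simp add: fun_eq_iff cone_mul_def mul_add_right vs.scale_right_distrib)
  moreover have "cone_mul V i j s (\<lambda>k. scal V c (t k)) = (\<lambda>k. scal V c (cone_mul V i j s t k))"
    if t: "t \<in> comp (row_cone V) j" for t c
    using S t[THEN row_cone_compD] t[THEN row_cone_comp0]
    by (simp add: fun_eq_iff cone_mul_def mul_scale_right vs.scale_right_distrib mult.commute)
  ultimately show ?thesis
    using s by (simp add: linear_between_def row_cone_simps cone_mul_mem)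
qed

lemma cone_mul_linear_left:
  assumes t: "t \<in> comp (row_cone V) j"
  shows "linear_between (scal (row_cone V)) (comp (row_cone V) i)
     (scal (row_cone V)) (comp (row_cone V) (i + j)) (\<lambda>s. mul (row_cone V) i j s t)"
proof -
  note T = row_cone_comp0[OF t] row_cone_compD[OF t]
  have "cone_mul V i j (s + u) t = cone_mul V i j s t + cone_mul V i j u t"
    if s: "s \<in> comp (row_cone V) i" and u: "u \<in> comp (row_cone V) i" for s u
    using T s[THEN row_cone_compD] u[THEN row_cone_compD] s[THEN row_cone_comp0] u[THEN row_cone_comp0]
    by (simp add: fun_eq_iff cone_mul_def mul_add_left vs.scale_right_distrib)
  moreover have "cone_mul V i j (\<lambda>k. scal V c (s k)) t = (\<lambda>k. scal V c (cone_mul V i j s t k))"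
    if s: "s \<in> comp (row_cone V) i" for s c
    using T s[THEN row_cone_compD] s[THEN row_cone_comp0]
    by (simp add: fun_eq_iff cone_mul_def mul_scale_left vs.scale_right_distrib mult.commute)
  ultimately show ?thesis
    using t by (simp add: linear_between_def row_cone_simps cone_mul_mem)
qed

text \<open>
  Outside column 0 both sides expand to three terms, according to which factor contributes its entry
  of column \<open>k\<close>; the terms match by associativity in \<open>V\<close>, and the signs by additivity of the
  exponent in the degree.
\<close>

lemma cone_mul_assoc:
  assumes s: "s \<in> comp (row_cone V) i" and t: "t \<in> comp (row_cone V) j"
    and u: "u \<in> comp (row_cone V) l"
  shows "cone_mul V (i + j) l (cone_mul V i j s t) u = cone_mul V i (j + l) s (cone_mul V j l t u)"
proof (rule ext)
  fix k
  let ?k = "int k"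
  let ?e = "\<lambda>m::int. (-1::complex) powi (?k * m)"
  have e: "?e (j + l) = ?e j * ?e l"
    by (simp add: power_int_add distrib_left)
  note s0 = row_cone_comp0[OF s] and t0 = row_cone_comp0[OF t] and u0 = row_cone_comp0[OF u]
  note sk = row_cone_compD[OF s, of k] and tk = row_cone_compD[OF t, of k]
    and uk = row_cone_compD[OF u, of k]
  show "cone_mul V (i + j) l (cone_mul V i j s t) u k =
    cone_mul V i (j + l) s (cone_mul V j l t u) k"
  proof (cases "k = 0")
    case True
    then show ?thesis by (simp add: cone_mul_def mul_assoc s0 t0 u0)
  next
    case False
    have "mul V (i + j + ?k) l (mul V i (j + ?k) (s 0) (t k)) (u 0) =
        mul V i (j + l + ?k) (s 0) (mul V (j + ?k) l (t k) (u 0))"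
      using mul_assoc[OF s0 tk u0] by (simp add: ac_simps)
    moreover have "mul V (i + j + ?k) l (mul V (i + ?k) j (s k) (t 0)) (u 0) =
        mul V (i + ?k) (j + l) (s k) (mul V j l (t 0) (u 0))"
      using mul_assoc[OF sk t0 u0] by (simp add: ac_simps)
    moreover have "mul V (i + j) (l + ?k) (mul V i j (s 0) (t 0)) (u k) =
        mul V i (j + l + ?k) (s 0) (mul V j (l + ?k) (t 0) (u k))"
      using mul_assoc[OF s0 t0 uk] by (simp add: ac_simps)
    ultimately show ?thesis
      using False cone_mul_terms_mem[OF s t, of k] cone_mul_terms_mem[OF t u, of k] s0 u0
      by (simp add: cone_mul_def mul_add_left mul_add_right mul_scale_left mul_scale_right
          comp_scale vs.scale_right_distrib e mult.commute add.assoc)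
  qed
qed

text \<open>
  Swapping the factors exchanges the two terms outside column 0. The sign for swapping an entry of
  column \<open>k\<close> in \<open>V\<close> differs from the required one by exactly the sign built into the product.
\<close>

lemma cone_mul_comm:
  assumes s: "s \<in> comp (row_cone V) i" and t: "t \<in> comp (row_cone V) j"
  shows "cone_mul V i j s t k = scal V ((-1) powi (i * j)) (cone_mul V j i t s k)"
proof (cases "k = 0")
  case True
  then show ?thesis
    using mul_comm[OF row_cone_comp0[OF s] row_cone_comp0[OF t]] by (simp add: cone_mul_def)
next
  case False
  let ?k = "int k"
  have "mul V i (j + ?k) (s 0) (t k) =
      scal V ((-1) powi (i * (j + ?k))) (mul V (j + ?k) i (t k) (s 0))"
    by (rule mul_comm[OF row_cone_comp0[OF s] row_cone_compD[OF t]])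
  moreover have "mul V (i + ?k) j (s k) (t 0) =
      scal V ((-1) powi ((i + ?k) * j)) (mul V j (i + ?k) (t 0) (s k))"
    by (rule mul_comm[OF row_cone_compD[OF s] row_cone_comp0[OF t]])
  moreover have "(-1 :: complex) powi (i * (j + ?k)) = (-1) powi (i * j) * (-1) powi (?k * i)"
    by (simp add: power_int_add distrib_left mult.commute)
  moreover have "(-1 :: complex) powi (?k * j) * (-1) powi ((i + ?k) * j) = (-1) powi (i * j)"
  proof -
    \<comment> \<open>The column sign occurs twice and cancels.\<close>
    have "(-1 :: complex) powi (?k * j) * (-1) powi ((i + ?k) * j) =
        (-1) powi (i * j + 2 * (?k * j))"
      by (subst power_int_add[symmetric]) (simp_all add: algebra_simps)
    also have "\<dots> = (-1) powi (i * j)"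
      by (simp add: power_int_add power_int_mult)
    finally show ?thesis .
  qed
  ultimately show ?thesis
    using False by (simp add: cone_mul_def vs.scale_right_distrib add.commute)
qed

lemma cone_mul_in_column_0:
  assumes x: "x \<in> comp V i" and t: "t \<in> comp (row_cone V) j"
  shows "cone_mul V i j (in_column_0 x) t k = mul V i (j + int k) x (t k)"
    and "cone_mul V j i t (in_column_0 x) k =
      scal V ((-1) powi (int k * i)) (mul V (j + int k) i (t k) x)"
  using x row_cone_comp0[OF t] row_cone_compD[OF t, of k]
  by (simp_all add: cone_mul_def in_column_0_def)

lemma graded_comm_algebra_row_cone: "graded_comm_algebra (row_cone V)"
proof -
  have one: "unit_map V 0 1 \<in> comp V 0" by (rule unit_mem) (simp add: ground_complex_def)
  have unit: "cone_mul V 0 i (in_column_0 (unit_map V 0 1)) s = s"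
    "cone_mul V i 0 s (in_column_0 (unit_map V 0 1)) = s" if s: "s \<in> comp (row_cone V) i" for i s
    using row_cone_compD[OF s] cone_mul_in_column_0[OF one s]
    by (simp_all add: fun_eq_iff mul_unit_left mul_unit_right)
  show ?thesis
    unfolding graded_comm_algebra_def
  proof (intro conjI allI ballI cone_mul_linear_right cone_mul_linear_left)
    show "mul (row_cone V) i j s t = scal (row_cone V) ((-1) powi (i * j)) (mul (row_cone V) j i t s)"
      if "s \<in> comp (row_cone V) i" "t \<in> comp (row_cone V) j" for i j s t
      unfolding row_cone_simps by (rule ext) (rule cone_mul_comm[OF that])
  qed (simp_all add: row_cone_simps(3,4) cone_mul_assoc unit)
qed

lemma is_prob_space_row_cone: "is_prob_space (row_cone V)"
  unfolding is_prob_space_def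
  using is_complex_row_cone chain_map_unit_row_cone graded_comm_algebra_row_cone
    chain_map_expect_row_cone
  by (simp add: row_cone_simps in_column_0_def expect_unit)

text \<open>
  Column 0 is a subcomplex, since no horizontal map leaves it, and the product restricts to that of
  \<open>V\<close> there, so its inclusion respects all the structure.
\<close>

lemma is_algebraic_cone_row_cone: "is_algebraic_cone V (row_cone V) (\<lambda>n. in_column_0)"
  unfolding is_algebraic_cone_def is_cone_def prob_morphism_def
proof (intro conjI allI ballI is_prob_space_row_cone contractible_row_cone chain_map_in_column_0)
  show "inj_on in_column_0 (comp V n)" for n
    by (rule inj_onI) (metis in_column_0_def)
  show "in_column_0 (mul V i j x y) = mul (row_cone V) i j (in_column_0 x) (in_column_0 y)"
    if "x \<in> comp V i" "y \<in> comp V j" for i j x y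
    using that cone_mul_in_column_0(1)[OF that(1) in_column_0_mem[OF that(2)]]
    by (auto simp: fun_eq_iff row_cone_simps in_column_0_def)
qed (simp_all add: row_cone_simps in_column_0_def)

end

theorem lemma3p6:
  fixes V :: "'a::ab_group_add homotopy_prob_space"
  assumes "is_prob_space V"
  shows "\<exists>(CV :: (nat \<Rightarrow> 'a) homotopy_prob_space) f. is_algebraic_cone V CV f"
  using prob_space_facts.is_algebraic_cone_row_cone[of V] assms
  unfolding prob_space_facts_def by blast

end
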